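(* Let $G$ be a locally compact topological group and let $X$ be a compact continuous $G$-space. Then Properties $(P_1(G,X))$ and $(P_1^*(G,X))$ are equivalent.
   Context: All topological spaces are Hausdorff. $\lambda$ is a left Haar measure on $G$ and $L^1G=L^1(G,\lambda)$. A compact continuous $G$-space is a compact space $X$ with a left action of $G$ such that $G\times X\to X$ is continuous. $G$ acts on $L^1G$ by left translation $(g\psi)(t)=\psi(g^{-1}t)$, and on $C(X,L^1G)$ (with the uniform norm) by the diagonal action $(g\cdot f)(x)=g\cdot f(g^{-1}x)$. Let $S(G)=\{\psi\in L^1G:\psi\ge0\text{ almost everywhere and }\int_G\psi\,d\lambda=1\}$. For $K\subseteq G$ and $\epsilon>0$, a vector $v$ of a Banach space on which $G$ acts by linear isometries is $(K,\epsilon)$-invariant if $\|g\cdot v-v\|<\epsilon$ for every $g\in K$. Property $(P_1(G,X))$: for every compact subset $K$ of $G$ and every $\epsilon>0$ there exists a $(K,\epsilon)$-invariant map $f$ in $C(X,L^1G)$ such that $f(X)\subseteq S(G)$. Property $(P_1^*(G,X))$: for every finite subset $K$ of $G$ and every $\epsilon>0$ there exists a $(K,\epsilon)$-invariant map $f$ in $C(X,L^1G)$ such that $f(X)\subseteq S(G)$. *)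

theory Defs
  imports "HOL-Analysis.Analysis"
begin

text \<open>
  Groups are written additively, because the library's class of topological groups is
  \<^class>\<open>topological_group_add\<close>. The class \<^class>\<open>group_add\<close> does not assume commutativity, so
  \<open>g + h\<close>, \<open>- g\<close> and \<open>0\<close> stand for the product, the inverse and the identity of an arbitrary group.
\<close>

class locally_compact_group = topological_group_add + t2_space +
  assumes compact_neighbourhood: "\<exists>U K. open U \<and> compact K \<and> x \<in> U \<and> U \<subseteq> K"

text \<open>
  A left Haar measure is a nonzero left-invariant Radon measure on the Borel sets. No countability
  assumption is made on the group, so Radon is spelled out: finite on compact sets,
  outer regular on Borel sets and inner regular on open sets. The Borel sets appear as
  \<open>sigma_sets UNIV {U. open U}\<close> because \<^const>\<open>borel\<close> cannot be mentioned inside a class declaration.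
\<close>

definition (in topological_group_add) left_haar_measure :: "'a measure \<Rightarrow> bool" where
  "left_haar_measure M \<longleftrightarrow>
     space M = UNIV \<and>
     sets M = sigma_sets UNIV {U. open U} \<and>
     (\<forall>K. compact K \<longrightarrow> emeasure M K < \<infinity>) \<and>
     (\<forall>A \<in> sets M. emeasure M A = (INF U \<in> {U. open U \<and> A \<subseteq> U}. emeasure M U)) \<and>
     (\<forall>U. open U \<longrightarrow> emeasure M U = (SUP K \<in> {K. compact K \<and> K \<subseteq> U}. emeasure M K)) \<and>
     (\<forall>g. \<forall>A \<in> sets M. emeasure M ((\<lambda>t. g + t) ` A) = emeasure M A) \<and>
     emeasure M UNIV \<noteq> 0"

text \<open>A locally compact group together with a chosen left Haar measure.\<close>

class haar_group = locally_compact_group +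
  fixes haar :: "'a measure"
  assumes left_haar_measure_haar: "left_haar_measure haar"

lemma sets_haar [simp, measurable_cong]: "sets (haar :: 'g::haar_group measure) = sets borel"
  using left_haar_measure_haar[where 'a = 'g] by (simp add: left_haar_measure_def sets_borel)

lemma space_haar [simp]: "space (haar :: 'g::haar_group measure) = UNIV"
  using sets_eq_imp_space_eq[OF sets_haar] by simp

lemma borel_measurable_left_translation:
  "(\<lambda>t. g + t) \<in> borel_measurable (borel :: 'g::topological_group_add measure)"
  by (intro borel_measurable_continuous_onI continuous_intros)

lemma distr_haar_left_translation:
  "distr haar haar (\<lambda>t. g + t) = (haar :: 'g::haar_group measure)"
proof (rule measure_eqI)
  have m: "(\<lambda>t. g + t) \<in> measurable haar (haar :: 'g measure)"
    using borel_measurable_left_translation[of g] by (simp cong: measurable_cong_sets)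
  fix A :: "'g set" assume "A \<in> sets (distr haar haar (\<lambda>t. g + t))"
  then have A: "A \<in> sets borel" by simp
  have "(\<lambda>t. g + t) -` A = (\<lambda>t. - g + t) ` A"
    by (force simp: image_iff add.assoc[symmetric])
  moreover have "emeasure haar ((\<lambda>t. - g + t) ` A) = emeasure haar A"
    using left_haar_measure_haar[where 'a = 'g] A unfolding left_haar_measure_def by (metis sets_haar)
  ultimately show "emeasure (distr haar haar (\<lambda>t. g + t)) A = emeasure haar A"
    using A by (simp add: emeasure_distr[OF m])
qed simp

lemma measurable_left_translation_haar:
  "(\<lambda>t. g + t) \<in> measurable haar (haar :: 'g::haar_group measure)"
  using borel_measurable_left_translation[of g] by (simp cong: measurable_cong_sets)

lemma integrable_left_translation:
  fixes \<psi> :: "'g::haar_group \<Rightarrow> real"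
  shows "integrable haar \<psi> \<Longrightarrow> integrable haar (\<lambda>t. \<psi> (g + t))"
  using integrable_distr[OF measurable_left_translation_haar, of g \<psi>]
  by (simp add: distr_haar_left_translation)

lemma integral_left_translation:
  fixes \<psi> :: "'g::haar_group \<Rightarrow> real"
  assumes "integrable haar \<psi>"
  shows "(\<integral>t. \<psi> (g + t) \<partial>haar) = (\<integral>t. \<psi> t \<partial>haar)"
  using integral_distr[OF measurable_left_translation_haar[of g], of \<psi>] assms
  by (simp add: distr_haar_left_translation)

lemma AE_left_translation:
  fixes g :: "'g::haar_group"
  assumes "AE t in haar. P t"
  shows "AE t in haar. P (g + t)"
proof (rule AE_distrD[OF measurable_left_translation_haar])
  show "AE t in distr haar haar (\<lambda>t. g + t). P t"
    using assms by (simp only: distr_haar_left_translation)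
qed


subsection \<open>The Banach space of integrable functions modulo null functions\<close>

definition L1_rel :: "('g::haar_group \<Rightarrow> real) \<Rightarrow> ('g \<Rightarrow> real) \<Rightarrow> bool" where
  "L1_rel \<phi> \<psi> \<longleftrightarrow> integrable haar \<phi> \<and> integrable haar \<psi> \<and> (AE t in haar. \<phi> t = \<psi> t)"

lemma part_equivp_L1_rel: "part_equivp (L1_rel :: ('g::haar_group \<Rightarrow> real) \<Rightarrow> _)"
proof (rule part_equivpI)
  show "\<exists>\<phi> :: 'g \<Rightarrow> real. L1_rel \<phi> \<phi>"
    by (rule exI[of _ "\<lambda>_. 0"]) (simp add: L1_rel_def)
  show "symp (L1_rel :: ('g \<Rightarrow> real) \<Rightarrow> _)"
    by (auto simp: L1_rel_def intro!: sympI)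
  show "transp (L1_rel :: ('g \<Rightarrow> real) \<Rightarrow> _)"
    by (auto simp: L1_rel_def intro!: transpI)
qed

quotient_type (overloaded) 'g L1 = "'g::haar_group \<Rightarrow> real" / partial: L1_rel
  by (rule part_equivp_L1_rel)

instantiation L1 :: (haar_group) real_vector
begin

lift_definition zero_L1 :: "'a L1" is "\<lambda>_. 0"
  by (simp add: L1_rel_def)

lift_definition plus_L1 :: "'a L1 \<Rightarrow> 'a L1 \<Rightarrow> 'a L1" is "\<lambda>\<phi> \<psi> t. \<phi> t + \<psi> t"
  by (auto simp: L1_rel_def)

lift_definition minus_L1 :: "'a L1 \<Rightarrow> 'a L1 \<Rightarrow> 'a L1" is "\<lambda>\<phi> \<psi> t. \<phi> t - \<psi> t"
  by (auto simp: L1_rel_def)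

lift_definition uminus_L1 :: "'a L1 \<Rightarrow> 'a L1" is "\<lambda>\<psi> t. - \<psi> t"
  by (auto simp: L1_rel_def)

lift_definition scaleR_L1 :: "real \<Rightarrow> 'a L1 \<Rightarrow> 'a L1" is "\<lambda>c \<psi> t. c * \<psi> t"
  by (auto simp: L1_rel_def)

instance
proof
  fix u v w :: "'a L1" and a b :: real
  show "u + v + w = u + (v + w)"
    by transfer (auto simp: L1_rel_def algebra_simps)
  show "u + v = v + u"
    by transfer (auto simp: L1_rel_def algebra_simps)
  show "0 + u = u"
    by transfer (auto simp: L1_rel_def)
  show "- u + u = 0"
    by transfer (auto simp: L1_rel_def)
  show "u - v = u + - v"
    by transfer (auto simp: L1_rel_def)
  show "a *\<^sub>R (u + v) = a *\<^sub>R u + a *\<^sub>R v"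
    by transfer (auto simp: L1_rel_def algebra_simps)
  show "(a + b) *\<^sub>R u = a *\<^sub>R u + b *\<^sub>R u"
    by transfer (auto simp: L1_rel_def algebra_simps)
  show "a *\<^sub>R b *\<^sub>R u = (a * b) *\<^sub>R u"
    by transfer (auto simp: L1_rel_def algebra_simps)
  show "1 *\<^sub>R u = u"
    by transfer (auto simp: L1_rel_def)
qed

end

instantiation L1 :: (haar_group) real_normed_vector
begin

lift_definition norm_L1 :: "'a L1 \<Rightarrow> real" is "\<lambda>\<psi>. \<integral>t. \<bar>\<psi> t\<bar> \<partial>haar"
  unfolding L1_rel_def by (auto intro!: integral_cong_AE)

definition dist_L1 :: "'a L1 \<Rightarrow> 'a L1 \<Rightarrow> real" where
  "dist_L1 u v = norm (u - v)"

definition sgn_L1 :: "'a L1 \<Rightarrow> 'a L1" where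
  "sgn_L1 u = u /\<^sub>R norm u"

definition uniformity_L1 :: "('a L1 \<times> 'a L1) filter" where
  "uniformity_L1 = (INF e \<in> {0<..}. principal {(u, v). dist u v < e})"

definition open_L1 :: "'a L1 set \<Rightarrow> bool" where
  "open_L1 U \<longleftrightarrow> (\<forall>u\<in>U. \<forall>\<^sub>F (u', v) in uniformity. u' = u \<longrightarrow> v \<in> U)"

instance
proof
  fix u v :: "'a L1" and a :: real
  show "dist u v = norm (u - v)"
    by (rule dist_L1_def)
  show "sgn u = u /\<^sub>R norm u"
    by (rule sgn_L1_def)
  show "uniformity = (INF e \<in> {0<..}. principal {(u :: 'a L1, v). dist u v < e})"
    by (rule uniformity_L1_def)
  show "open U \<longleftrightarrow> (\<forall>u\<in>U. \<forall>\<^sub>F (u', v) in uniformity. u' = u \<longrightarrow> v \<in> U)" for U :: "'a L1 set"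
    by (rule open_L1_def)
  show "norm u = 0 \<longleftrightarrow> u = 0"
    by transfer (auto simp: L1_rel_def integral_nonneg_eq_0_iff_AE)
  show "norm (u + v) \<le> norm u + norm v"
  proof transfer
    fix \<phi> \<psi> :: "'a \<Rightarrow> real"
    assume "L1_rel \<phi> \<phi>" "L1_rel \<psi> \<psi>"
    then have i: "integrable haar \<phi>" "integrable haar \<psi>"
      by (auto simp: L1_rel_def)
    have "(\<integral>t. \<bar>\<phi> t + \<psi> t\<bar> \<partial>haar) \<le> (\<integral>t. \<bar>\<phi> t\<bar> + \<bar>\<psi> t\<bar> \<partial>haar)"
      using i by (intro integral_mono) auto
    then show "(\<integral>t. \<bar>\<phi> t + \<psi> t\<bar> \<partial>haar) \<le> (\<integral>t. \<bar>\<phi> t\<bar> \<partial>haar) + (\<integral>t. \<bar>\<psi> t\<bar> \<partial>haar)"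
      using i by simp
  qed
  show "norm (a *\<^sub>R u) = \<bar>a\<bar> * norm u"
    by transfer (auto simp: abs_mult)
qed

end

lift_definition L1_nonneg :: "'g::haar_group L1 \<Rightarrow> bool" is "\<lambda>\<psi>. AE t in haar. 0 \<le> \<psi> t"
  unfolding L1_rel_def by (auto elim!: eventually_elim2)

lift_definition L1_integral :: "'g::haar_group L1 \<Rightarrow> real" is "\<lambda>\<psi>. \<integral>t. \<psi> t \<partial>haar"
  unfolding L1_rel_def by (auto intro!: integral_cong_AE)

lift_definition L1_translate :: "'g::haar_group \<Rightarrow> 'g L1 \<Rightarrow> 'g L1" is "\<lambda>g \<psi> t. \<psi> (- g + t)"
  unfolding L1_rel_def
  using AE_left_translation[where P = "\<lambda>t. (_ :: 'g \<Rightarrow> real) t = _ t"]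
  by (auto intro: integrable_left_translation)

definition prob_densities :: "'g::haar_group L1 set" where
  "prob_densities = {\<psi>. L1_nonneg \<psi> \<and> L1_integral \<psi> = 1}"


subsection \<open>Actions and the two properties\<close>

definition continuous_G_space :: "('g::topological_group_add \<Rightarrow> 'x::topological_space \<Rightarrow> 'x) \<Rightarrow> bool" where
  "continuous_G_space act \<longleftrightarrow>
     (\<forall>x. act 0 x = x) \<and>
     (\<forall>g h x. act (g + h) x = act g (act h x)) \<and>
     continuous_on UNIV (\<lambda>(g, x). act g x)"

text \<open>
  For compact \<open>X\<close>, every continuous function on \<open>X\<close> is bounded, so the Banach space \<open>C(X, L\<^sup>1 G)\<close> is the
  library's space of bounded continuous functions with its supremum norm.
\<close>

definition diagonal_action ::
  "('g::haar_group \<Rightarrow> 'x::topological_space \<Rightarrow> 'x) \<Rightarrow> 'g \<Rightarrow> ('x \<Rightarrow>\<^sub>C 'g L1) \<Rightarrow> ('x \<Rightarrow>\<^sub>C 'g L1)" where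
  "diagonal_action act g f = Bcontfun (\<lambda>x. L1_translate g (apply_bcontfun f (act (- g) x)))"

definition invariant_vector ::
  "('g \<Rightarrow> 'v \<Rightarrow> 'v::real_normed_vector) \<Rightarrow> 'g set \<Rightarrow> real \<Rightarrow> 'v \<Rightarrow> bool" where
  "invariant_vector \<alpha> K \<epsilon> v \<longleftrightarrow> (\<forall>g\<in>K. norm (\<alpha> g v - v) < \<epsilon>)"

definition property_P1 :: "('g::haar_group \<Rightarrow> 'x::topological_space \<Rightarrow> 'x) \<Rightarrow> bool" where
  "property_P1 act \<longleftrightarrow>
     (\<forall>K :: 'g set. compact K \<longrightarrow> (\<forall>\<epsilon>>0. \<exists>f :: 'x \<Rightarrow>\<^sub>C 'g L1.
        invariant_vector (diagonal_action act) K \<epsilon> f \<and> range (apply_bcontfun f) \<subseteq> prob_densities))"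

definition property_P1_star :: "('g::haar_group \<Rightarrow> 'x::topological_space \<Rightarrow> 'x) \<Rightarrow> bool" where
  "property_P1_star act \<longleftrightarrow>
     (\<forall>K :: 'g set. finite K \<longrightarrow> (\<forall>\<epsilon>>0. \<exists>f :: 'x \<Rightarrow>\<^sub>C 'g L1.
        invariant_vector (diagonal_action act) K \<epsilon> f \<and> range (apply_bcontfun f) \<subseteq> prob_densities))"

text \<open>
  The next facts show that the argument of \<^const>\<open>Bcontfun\<close> in the diagonal action is indeed bounded
  and continuous, so that the action has the expected values.
\<close>

lemma L1_translate_diff: "L1_translate g (u - v) = L1_translate g u - L1_translate g v"
  by transfer (auto simp: L1_rel_def intro: integrable_left_translation)

lemma norm_L1_translate: "norm (L1_translate g u) = norm u"
proof transfer
  fix g :: 'a and \<psi> :: "'a \<Rightarrow> real"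
  assume "L1_rel \<psi> \<psi>"
  then have "integrable haar (\<lambda>t. \<bar>\<psi> t\<bar>)" by (simp add: L1_rel_def)
  from integral_left_translation[OF this, of "- g"]
  show "(\<integral>t. \<bar>\<psi> (- g + t)\<bar> \<partial>haar) = (\<integral>t. \<bar>\<psi> t\<bar> \<partial>haar)" .
qed

lemma apply_diagonal_action:
  fixes act :: "'g::haar_group \<Rightarrow> 'x::topological_space \<Rightarrow> 'x"
  assumes "continuous_G_space act"
  shows "apply_bcontfun (diagonal_action act g f) x = L1_translate g (apply_bcontfun f (act (- g) x))"
proof -
  have "continuous_on UNIV ((\<lambda>(g, x). act g x) \<circ> (\<lambda>x. (- g, x)))"
    using assms unfolding continuous_G_space_def
    by (intro continuous_on_compose continuous_intros) (auto intro: continuous_on_subset)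
  then have 1: "continuous_on UNIV (act (- g))"
    by (simp add: o_def)
  have 2: "continuous_on UNIV (L1_translate g :: 'g L1 \<Rightarrow> _)"
    by (auto simp: continuous_on_iff dist_norm L1_translate_diff[symmetric] norm_L1_translate)
  have 3: "continuous_on UNIV (\<lambda>x. L1_translate g (apply_bcontfun f (act (- g) x)))"
    using continuous_on_compose2[OF 2 continuous_on_compose2[OF continuous_on_apply_bcontfun[of UNIV f] 1]]
    by simp
  have "(\<lambda>x. L1_translate g (apply_bcontfun f (act (- g) x))) \<in> bcontfun"
    by (rule bcontfun_normI[OF 3, of "norm f"]) (simp add: norm_L1_translate norm_bounded)
  then show ?thesis
    by (simp add: diagonal_action_def Bcontfun_inverse)
qed

end

theory Submission
  imports Defs
begin

text \<open>
  Finite sets are compact, so only the passage from finite to compact sets has content. In it the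
  convolution trick of Reiter is applied to the diagonal action \<open>\<alpha>\<close> on \<open>C(X, L\<^sup>1 G)\<close>. Convolving a
  vector \<open>f\<close> with a probability density \<open>\<beta>\<close> gives a vector \<open>\<beta> * f\<close> whose modulus of continuity under
  \<open>\<alpha>\<close> depends on \<open>\<beta>\<close> only, so that \<open>\<beta> * f\<close> is a candidate for invariance under all of \<open>K\<close>. Let a
  second probability measure \<open>\<eta>\<close> be supported so near to the identity that left convolution with \<open>\<eta>\<close>
  barely changes the translates \<open>g \<beta>\<close> for \<open>g \<in> K \<union> {0}\<close>. Then \<open>g (\<beta> * f)\<close> is close to
  \<open>\<eta> * (g \<beta>) * f\<close>, which is the average of \<open>\<eta> * (s f)\<close> over \<open>s\<close> with respect to \<open>g \<beta>\<close>. Right translation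
  acts continuously on \<open>\<eta>\<close>, therefore \<open>\<eta> * (s f)\<close> changes little when \<open>s\<close> is multiplied on the left by
  an element near the identity, and the compactly many \<open>s\<close> that occur are within such elements of a
  finite set \<open>F\<close>. If \<open>f\<close> is almost invariant under \<open>F\<close>, then \<open>\<eta> * (s f)\<close> is close to \<open>\<eta> * f\<close>. Thus
  every \<open>g (\<beta> * f)\<close> is close to the one vector \<open>\<eta> * f\<close>, and in particular to \<open>\<beta> * f\<close>. The set \<open>F\<close> depends
  on \<open>\<beta>\<close>, \<open>\<eta>\<close> and \<open>K\<close>, but not on \<open>f\<close>; this is \<open>finite_test_set\<close>.

  Two choices keep the measure theory elementary. First, \<open>\<beta>\<close> is the normalised indicator of a compact
  set with respect to the left Haar measure, and \<open>\<eta>\<close> is the image under inversion of another one, hence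
  has a density with respect to a right Haar measure. Then only
  \<open>\<lambda>((g + A) - A) \<longrightarrow> 0\<close> is needed (\<open>eventually_translate_compact_near\<close>), and no modular function.
  Secondly, once \<open>f\<close> is given, the convolutions are replaced by Riemann sums, finite convex combinations
  of translates of \<open>f\<close>. The errors of these sums are controlled by the continuity of \<open>g \<mapsto> \<alpha> g f\<close>
  (\<open>haar_average_translate\<close>). No vector-valued integral and no product measure appears, so it does not
  matter that \<open>L\<^sup>1 G\<close> may be nonseparable and Haar measure not \<open>\<sigma>\<close>-finite. Convex combinations of
  translates also take values in the probability densities again.

  It remains to see that the orbit maps of \<open>\<alpha>\<close> are norm continuous. This follows from the strong
  continuity of left translation on \<open>L\<^sup>1 G\<close> and the compactness of \<open>X\<close>
  (\<open>continuous_on_diagonal_action\<close>).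
\<close>

text \<open>
  The tube lemma, in the form in which it turns pointwise closeness into closeness uniform on a compact set.
\<close>

lemma eventually_nhds_uniformly_on_compact:
  fixes x0 :: "'a::topological_space" and K :: "'b::topological_space set"
  assumes "compact K" "open W" "\<And>x. x \<in> K \<Longrightarrow> (x0, x) \<in> W"
  shows "\<forall>\<^sub>F y in nhds x0. \<forall>x\<in>K. (y, x) \<in> W"
proof -
  have "{x0} \<times> K \<subseteq> W" using assms(3) by auto
  from Elementary_Topology.tube_lemma[OF assms(1,2) this] obtain X
    where X: "x0 \<in> X" "open X" "X \<times> K \<subseteq> W" by blast
  have "\<forall>y\<in>X. \<forall>x\<in>K. (y, x) \<in> W" using X(3) by blast
  with X(1,2) show ?thesis unfolding eventually_nhds by blast
qed

section \<open>Haar measure of compact sets\<close>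

lemma haar_compact_less_top: "compact K \<Longrightarrow> emeasure haar (K :: 'g::haar_group set) < \<infinity>"
  using left_haar_measure_haar[where 'a = 'g] by (simp add: left_haar_measure_def)

lemma haar_outer_regular:
  fixes A :: "'g::haar_group set"
  assumes "A \<in> sets borel" "emeasure haar A < c"
  obtains U where "open U" "A \<subseteq> U" "emeasure haar U < c"
proof -
  have "emeasure haar A = (INF U \<in> {U. open U \<and> A \<subseteq> U}. emeasure haar U)"
    using left_haar_measure_haar[where 'a = 'g] assms(1)
    unfolding left_haar_measure_def by (metis sets_haar)
  with assms(2) have "(INF U \<in> {U. open U \<and> A \<subseteq> U}. emeasure haar U) < c"
    by simp
  then show ?thesis
    unfolding INF_less_iff using that by blast
qed

lemma haar_inner_regular:
  fixes U :: "'g::haar_group set"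
  assumes "open U" "c < emeasure haar U"
  obtains K where "compact K" "K \<subseteq> U" "c < emeasure haar K"
proof -
  have "emeasure haar U = (SUP K \<in> {K. compact K \<and> K \<subseteq> U}. emeasure haar K)"
    using left_haar_measure_haar[where 'a = 'g] assms(1)
    unfolding left_haar_measure_def by metis
  with assms(2) have "c < (SUP K \<in> {K. compact K \<and> K \<subseteq> U}. emeasure haar K)"
    by simp
  then show ?thesis
    unfolding less_SUP_iff using that by blast
qed

lemma emeasure_haar_translate:
  fixes A :: "'g::haar_group set"
  assumes "A \<in> sets borel"
  shows "emeasure haar ((+) g ` A) = emeasure haar A"
  using left_haar_measure_haar[where 'a = 'g] assms
  unfolding left_haar_measure_def by (metis sets_haar)

lemma compact_haar_sets: "compact (K :: 'g::haar_group set) \<Longrightarrow> K \<in> sets haar"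
  using borel_compact[of K] by simp

lemma compact_translate: "compact K \<Longrightarrow> compact ((+) g ` (K :: 'g::haar_group set))"
  by (rule compact_continuous_image[rotated]) (auto intro!: continuous_intros)

lemma compact_fmeasurable: "compact (K :: 'g::haar_group set) \<Longrightarrow> K \<in> fmeasurable haar"
  using compact_haar_sets[of K] haar_compact_less_top[of K] by (simp add: fmeasurable_def)

lemma open_translate: "open U \<Longrightarrow> open ((+) g ` (U :: 'g::topological_group_add set))"
proof -
  assume "open U"
  then have "open ((+) (- g) -` U)"
    by (intro open_vimage continuous_intros)
  moreover have "(+) (- g) -` U = (+) g ` U"
    by (force simp: image_iff add.assoc[symmetric])
  ultimately show ?thesis by simp
qed

text \<open>
  Finitely many translates of \<open>U\<close> cover any given compact set, and some compact set has positive measure.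
\<close>

lemma open_haar_pos:
  fixes U :: "'g::haar_group set"
  assumes "open U" "U \<noteq> {}"
  shows "0 < emeasure haar U"
proof (rule ccontr)
  assume "\<not> 0 < emeasure haar U"
  then have U0: "emeasure haar U = 0" by simp
  obtain u where u: "u \<in> U" using assms by blast
  have "0 < emeasure haar (UNIV :: 'g set)"
    using left_haar_measure_haar[where 'a = 'g]
    unfolding left_haar_measure_def zero_less_iff_neq_zero by blast
  then obtain K :: "'g set" where K: "compact K" "0 < emeasure haar K"
    by (rule haar_inner_regular[OF open_UNIV])
  have "K \<subseteq> (\<Union>x\<in>UNIV. (+) x ` U)"
  proof
    fix x assume "x \<in> K"
    have "x = (x - u) + u" by simp
    then show "x \<in> (\<Union>x\<in>UNIV. (+) x ` U)" using u by blast
  qed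
  then obtain F where F: "finite F" "K \<subseteq> (\<Union>x\<in>F. (+) x ` U)"
    by (rule compactE_image[OF K(1) open_translate[OF assms(1)]])
  have "emeasure haar K \<le> emeasure haar (\<Union>x\<in>F. (+) x ` U)"
    using F open_translate[OF assms(1)] by (intro emeasure_mono) auto
  also have "\<dots> \<le> (\<Sum>x\<in>F. emeasure haar ((+) x ` U))"
    using F open_translate[OF assms(1)] by (intro emeasure_subadditive_finite) auto
  also have "\<dots> = 0"
    using U0 assms(1) by (simp add: emeasure_haar_translate)
  finally show False using K(2) by simp
qed

lemma compact_haar_pos_in_open:
  fixes U :: "'g::haar_group set"
  assumes "open U" "U \<noteq> {}"
  obtains A where "compact A" "A \<subseteq> U" "0 < measure haar A"
proof -
  obtain A where A: "compact A" "A \<subseteq> U" "0 < emeasure haar A"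
    by (rule haar_inner_regular[OF assms(1) open_haar_pos[OF assms]])
  then have "0 < measure haar A"
    using haar_compact_less_top[OF A(1)] by (simp add: measure_def enn2real_positive_iff)
  with A that show ?thesis by blast
qed

lemma measure_haar_translate:
  fixes A :: "'g::haar_group set"
  shows "A \<in> sets borel \<Longrightarrow> measure haar ((+) g ` A) = measure haar A"
  by (simp add: measure_def emeasure_haar_translate)

lemma fmeasurable_outer_approx:
  fixes A :: "'g::haar_group set"
  assumes A: "A \<in> fmeasurable haar" and "0 < \<delta>"
  obtains U where "open U" "A \<subseteq> U" "U \<in> fmeasurable haar" "measure haar (U - A) < \<delta>"
proof -
  have sA: "A \<in> sets borel" using fmeasurableD[OF A] by simp
  have "emeasure haar A < emeasure haar A + ennreal \<delta>"
    using fmeasurableD2[OF A] \<open>0 < \<delta>\<close>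
      ennreal_add_left_cancel_less[of "emeasure haar A" 0 "ennreal \<delta>"] by simp
  then obtain U where U: "open U" "A \<subseteq> U" "emeasure haar U < emeasure haar A + ennreal \<delta>"
    by (rule haar_outer_regular[OF sA])
  have fU: "U \<in> fmeasurable haar"
    using U(1,3) fmeasurableD2[OF A] by (intro fmeasurableI) (auto simp: less_top[symmetric])
  have "emeasure haar U = ennreal (measure haar U)" "emeasure haar A = ennreal (measure haar A)"
    using fU A by (simp_all add: emeasure_eq_measure2 fmeasurableD2)
  then have "measure haar U < measure haar A + \<delta>"
    using U(3) \<open>0 < \<delta>\<close> by (simp add: ennreal_plus[symmetric] ennreal_less_iff del: ennreal_plus)
  then have "measure haar (U - A) < \<delta>"
    using U(2) fU measurable_measure_Diff[of U haar A] sA by simp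
  with U(1,2) fU that show ?thesis by blast
qed

text \<open>
  If \<open>U \<supseteq> A\<close> is open with \<open>U - A\<close> of small measure, then by compactness of \<open>A\<close> all small translates of
  \<open>A\<close> stay inside \<open>U\<close>. Left invariance makes the two halves of the symmetric difference equally large, so
  bounding \<open>g + A - A\<close> is enough.
\<close>

lemma eventually_translate_compact_near:
  fixes A :: "'g::haar_group set"
  assumes A: "compact A" and "0 < \<delta>"
  shows "\<forall>\<^sub>F g in nhds 0. measure haar (sym_diff ((+) g ` A) A) < \<delta>"
proof -
  have fA: "A \<in> fmeasurable haar" by (rule compact_fmeasurable[OF A])
  then obtain U where U: "open U" "A \<subseteq> U" and fU: "U \<in> fmeasurable haar"
      and UA: "measure haar (U - A) < \<delta> / 2"
    by (rule fmeasurable_outer_approx[where \<delta> = "\<delta> / 2"]) (use \<open>0 < \<delta>\<close> in auto)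
  have "open ((\<lambda>p::'g \<times> 'g. fst p + snd p) -` U)"
    using U(1) by (intro open_vimage continuous_intros)
  then have "\<forall>\<^sub>F g in nhds (0::'g). \<forall>a\<in>A. (g, a) \<in> (\<lambda>p. fst p + snd p) -` U"
    using U(2) by (intro eventually_nhds_uniformly_on_compact[OF A]) auto
  then show ?thesis
  proof eventually_elim
    case (elim g)
    let ?B = "(+) g ` A"
    have B: "?B \<subseteq> U" using elim by auto
    have fB: "?B \<in> fmeasurable haar"
      by (rule compact_fmeasurable[OF compact_translate[OF A]])
    have fI: "?B \<inter> A \<in> fmeasurable haar"
      by (rule fmeasurable_Int_fmeasurable[OF fB compact_haar_sets[OF A]])
    have eq: "measure haar ?B = measure haar A"
      by (rule measure_haar_translate[OF borel_compact[OF A]])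
    have 1: "measure haar (?B - A) = measure haar (A - ?B)"
    proof -
      have "measure haar ?B = measure haar (?B - A) + measure haar (?B \<inter> A)"
        using measure_Un2[OF fI fB] by (simp add: Diff_Int Un_absorb1)
      moreover have "measure haar A = measure haar (A - ?B) + measure haar (?B \<inter> A)"
        using measure_Un2[OF fI fA] by (simp add: Diff_Int Un_absorb1)
      ultimately show ?thesis using eq by simp
    qed
    have 2: "measure haar (?B - A) \<le> measure haar (U - A)"
      using B fU borel_compact[OF A] borel_compact[OF compact_translate[OF A, of g]]
      by (intro measure_mono_fmeasurable) (auto intro!: fmeasurable_Diff)
    have "measure haar (sym_diff ?B A) \<le> measure haar (?B - A) + measure haar (A - ?B)"
      using borel_compact[OF A] borel_compact[OF compact_translate[OF A, of g]]
      by (intro measure_Un_le) auto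
    with 1 2 UA show ?case by simp
  qed
qed


section \<open>Averages of simple functions\<close>

text \<open>
  The mean value over \<open>A\<close> of a function with finitely many values. The simple integral only needs a real
  vector space as target, whereas the Bochner integral would need a separable Banach space.
\<close>

definition haar_average :: "'g::haar_group set \<Rightarrow> ('g \<Rightarrow> 'v::real_vector) \<Rightarrow> 'v" where
  "haar_average A z = Bochner_Integration.simple_bochner_integral haar (\<lambda>t. indicator A t *\<^sub>R z t) /\<^sub>R measure haar A"

lemma simple_bochner_integrable_indicator:
  fixes z :: "'g::haar_group \<Rightarrow> 'v::real_vector"
  assumes "A \<in> fmeasurable haar" "simple_function haar z"
  shows "Bochner_Integration.simple_bochner_integrable haar (\<lambda>t. indicator A t *\<^sub>R z t)"
proof
  have "simple_function haar (indicator A :: 'g \<Rightarrow> real)"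
    using assms(1) by (intro simple_function_indicator) (auto simp: fmeasurableD)
  then show "simple_function haar (\<lambda>t. indicator A t *\<^sub>R z t)"
    using assms(2) by (rule simple_function_compose2)
  have "emeasure haar {t \<in> space haar. indicator A t *\<^sub>R z t \<noteq> 0} \<le> emeasure haar A"
    using assms(1) by (intro emeasure_mono) (auto simp: fmeasurableD indicator_def)
  then show "emeasure haar {t \<in> space haar. indicator A t *\<^sub>R z t \<noteq> 0} \<noteq> \<infinity>"
    using fmeasurableD2[OF assms(1)] by (auto simp: top_unique)
qed

lemma haar_average_linear:
  assumes "linear L" "A \<in> fmeasurable haar" "simple_function haar z"
  shows "haar_average A (\<lambda>t. L (z t)) = L (haar_average A z)"
proof -
  have "(\<lambda>t. indicator A t *\<^sub>R L (z t)) = (\<lambda>t. L (indicator A t *\<^sub>R z t))"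
    using assms(1) by (simp add: linear_scale)
  then show ?thesis
    using simple_bochner_integral_linear[OF assms(1) simple_bochner_integrable_indicator[OF assms(2,3)]]
    by (simp add: haar_average_def linear_scale[OF assms(1)])
qed

lemma haar_average_add:
  assumes "A \<in> fmeasurable haar" "simple_function haar y" "simple_function haar z"
  shows "haar_average A (\<lambda>t. y t + z t) = haar_average A y + haar_average A z"
  using simple_bochner_integral_add[OF simple_bochner_integrable_indicator[OF assms(1,2)]
      simple_bochner_integrable_indicator[OF assms(1,3)]]
  by (simp add: haar_average_def scaleR_add_right)

text \<open>
  The average is a convex combination of the values on \<open>A\<close>. This one fact serves for norm estimates (with
  balls as \<open>C\<close>) as well as for staying among the maps into the probability densities.
\<close>

lemma haar_average_in_convex:
  fixes z :: "'g::haar_group \<Rightarrow> 'v::real_vector"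
  assumes A: "A \<in> fmeasurable haar" "0 < measure haar A" and z: "simple_function haar z"
    and C: "convex C" "\<And>t. t \<in> A \<Longrightarrow> z t \<in> C"
  shows "haar_average A z \<in> C"
proof -
  \<comment> \<open>The values of \<open>z\<close> on \<open>A\<close> must be kept apart from the value \<open>0\<close> off \<open>A\<close>, because \<open>z\<close> may vanish inside \<open>A\<close>.\<close>
  define p where "p t = (if t \<in> A then Some (z t) else None)" for t
  define w where "w y = measure haar {t. p t = y}" for y
  define Y where "Y = range p - {None}"
  have p: "simple_function haar p"
    unfolding p_def using A(1) simple_function_compose1[OF z]
    by (intro simple_function_If_set) (auto simp: fmeasurableD)
  have fin: "finite (range p)"
    using simple_functionD(1)[OF p] by simp
  have drop: "(\<Sum>y\<in>range p. w y *\<^sub>R h y) = (\<Sum>y\<in>Y. w y *\<^sub>R h y)" if "h None = 0"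
    for h :: "'v option \<Rightarrow> 'b::real_vector"
    unfolding Y_def using fin that by (intro sum.mono_neutral_right) auto
  have "Bochner_Integration.simple_bochner_integral haar (\<lambda>t. indicator A t *\<^sub>R z t)
      = (\<Sum>y\<in>range p. w y *\<^sub>R (case y of None \<Rightarrow> 0 | Some v \<Rightarrow> v))"
    unfolding w_def
    by (subst simple_bochner_integral_partition[OF simple_bochner_integrable_indicator[OF A(1) z] p,
        where v = "\<lambda>y. case y of None \<Rightarrow> 0 | Some v \<Rightarrow> v"])
      (auto simp: p_def split: if_splits)
  then have 1: "haar_average A z
      = (\<Sum>y\<in>Y. (w y / measure haar A) *\<^sub>R (case y of None \<Rightarrow> 0 | Some v \<Rightarrow> v))"
    by (simp add: haar_average_def drop scaleR_sum_right divide_inverse mult.commute)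
  have one: "simple_function haar (\<lambda>_::'g. 1::real)" by simp
  have i: "Bochner_Integration.simple_bochner_integrable haar (\<lambda>t. indicator A t *\<^sub>R (1::real))"
    by (rule simple_bochner_integrable_indicator[OF A(1) one])
  have "measure haar A = Bochner_Integration.simple_bochner_integral haar (\<lambda>t. indicator A t *\<^sub>R (1::real))"
    using A(1) by (subst simple_bochner_integrable_eq_integral[OF i]) simp
  also have "\<dots> = (\<Sum>y\<in>range p. w y *\<^sub>R (case y of None \<Rightarrow> 0 | Some v \<Rightarrow> 1))"
    unfolding w_def
    by (subst simple_bochner_integral_partition[OF i p,
        where v = "\<lambda>y. case y of None \<Rightarrow> 0 | Some v \<Rightarrow> 1"])
      (auto simp: p_def split: if_splits)
  also have "\<dots> = (\<Sum>y\<in>Y. w y)"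
    by (subst drop) (auto simp: Y_def split: option.splits intro!: sum.cong)
  finally have 2: "(\<Sum>y\<in>Y. w y / measure haar A) = 1"
    using A(2) by (simp add: sum_divide_distrib[symmetric])
  show ?thesis
    unfolding 1
  proof (rule convex_sum[OF _ C(1) 2])
    show "finite Y" using fin by (simp add: Y_def)
    show "0 \<le> w y / measure haar A" for y by (simp add: w_def)
    show "(case y of None \<Rightarrow> 0 | Some v \<Rightarrow> v) \<in> C" if "y \<in> Y" for y
      using that C(2) by (auto simp: Y_def p_def split: if_splits)
  qed
qed

lemma simple_function_left_translation:
  fixes z :: "'g::haar_group \<Rightarrow> 'v"
  shows "simple_function haar z \<Longrightarrow> simple_function haar (\<lambda>t. z (g + t))"
  using simple_function_comp[OF measurable_left_translation_haar, of z g] by (simp add: comp_def)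

lemma simple_bochner_integral_left_translation:
  fixes z :: "'g::haar_group \<Rightarrow> 'v::real_vector"
  assumes "simple_function haar z"
  shows "Bochner_Integration.simple_bochner_integral haar (\<lambda>t. z (g + t)) = Bochner_Integration.simple_bochner_integral haar z"
proof -
  have "range (\<lambda>t. z (g + t)) = range z"
  proof safe
    fix t
    show "z t \<in> range (\<lambda>t. z (g + t))"
      by (rule image_eqI[of _ _ "- g + t"]) (simp_all add: add.assoc[symmetric])
  qed auto
  moreover have "measure haar {t. z (g + t) = y} = measure haar {t. z t = y}" for y
  proof -
    have m: "{t. z t = y} \<in> sets haar"
      using simple_functionD(2)[OF assms, of "{y}"] by (simp add: vimage_def)
    have "measure haar {t. z t = y} = measure (distr haar haar (\<lambda>t. g + t)) {t. z t = y}"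
      by (simp add: distr_haar_left_translation)
    also have "\<dots> = measure haar {t. z (g + t) = y}"
      using m by (subst measure_distr[OF measurable_left_translation_haar]) auto
    finally show ?thesis by simp
  qed
  ultimately show ?thesis
    by (simp add: simple_bochner_integral_def)
qed

text \<open>
  Think of \<open>a\<close> and \<open>b\<close> as Riemann sum approximations on \<open>A\<close> of \<open>u\<close> and of \<open>t \<mapsto> u (g + t)\<close>. By left
  invariance the second average is the average of \<open>u\<close> over \<open>g + A\<close>; the two integrands agree up to \<open>2 \<epsilon>\<close> where
  both sets overlap and are bounded by 1 elsewhere.
\<close>

lemma haar_average_translate:
  fixes a b u :: "'g::haar_group \<Rightarrow> 'v::real_normed_vector"
  assumes A: "compact A" "0 < measure haar A"
    and sf: "simple_function haar a" "simple_function haar b"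
    and near: "\<And>t. t \<in> A \<Longrightarrow> norm (a t - u t) \<le> \<epsilon>" "\<And>t. t \<in> A \<Longrightarrow> norm (b t - u (g + t)) \<le> \<epsilon>"
    and bound: "\<And>t. t \<in> A \<Longrightarrow> norm (a t) \<le> 1" "\<And>t. t \<in> A \<Longrightarrow> norm (b t) \<le> 1"
    and sd: "measure haar (sym_diff ((+) g ` A) A) \<le> \<epsilon> * measure haar A"
  shows "norm (haar_average A b - haar_average A a) \<le> 3 * \<epsilon>"
proof -
  let ?I = "Bochner_Integration.simple_bochner_integral haar :: ('g \<Rightarrow> 'v) \<Rightarrow> 'v"
  let ?D = "sym_diff ((+) g ` A) A"
  define a' where "a' t = indicator A t *\<^sub>R a t" for t
  define b' where "b' t = indicator A (- g + t) *\<^sub>R b (- g + t)" for t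
  note fA = compact_fmeasurable[OF A(1)]
  note fB = compact_fmeasurable[OF compact_translate[OF A(1), of g]]
  have fD: "?D \<in> fmeasurable haar"
    using fA fB by auto
  have mem: "- g + t \<in> A \<longleftrightarrow> t \<in> (+) g ` A" for t
    by (force simp: image_iff add.assoc[symmetric])
  have b0: "Bochner_Integration.simple_bochner_integrable haar (\<lambda>t. indicator A t *\<^sub>R b t)"
    by (rule simple_bochner_integrable_indicator[OF fA sf(2)])
  have ib: "Bochner_Integration.simple_bochner_integrable haar b'"
  proof -
    have "b' = (\<lambda>t. indicator ((+) g ` A) t *\<^sub>R b (- g + t))"
      by (simp add: b'_def fun_eq_iff mem indicator_def)
    then show ?thesis
      using simple_bochner_integrable_indicator[OF fB
          simple_function_left_translation[OF sf(2), of "- g"]] by (simp only:)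
  qed
  have ia: "Bochner_Integration.simple_bochner_integrable haar a'"
    unfolding a'_def by (rule simple_bochner_integrable_indicator[OF fA sf(1)])
  have iD: "Bochner_Integration.simple_bochner_integrable haar (\<lambda>t. b' t - a' t)"
    using simple_bochner_integrable_compose2[OF _ ib ia, of "\<lambda>x y. x - y"] by simp
  have inD: "Bochner_Integration.simple_bochner_integrable haar (\<lambda>t. norm (b' t - a' t))"
    using simple_bochner_integrable_compose2[OF _ iD iD, of "\<lambda>x y. norm x"] by simp
  have "?I (\<lambda>t. indicator A t *\<^sub>R b t) = ?I b'"
    unfolding b'_def
    using simple_bochner_integral_left_translation[of "\<lambda>t. indicator A t *\<^sub>R b t" "- g"] b0
    by (auto elim: simple_bochner_integrable.cases)
  then have "norm (?I (\<lambda>t. indicator A t *\<^sub>R b t) - ?I a') = norm (?I (\<lambda>t. b' t - a' t))"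
    by (simp add: simple_bochner_integral_diff[OF ib ia])
  also have "\<dots> \<le> Bochner_Integration.simple_bochner_integral haar (\<lambda>t. norm (b' t - a' t))"
    by (rule simple_bochner_integral_norm_bound[OF iD])
  also have "\<dots> = (\<integral>t. norm (b' t - a' t) \<partial>haar)"
    by (rule simple_bochner_integrable_eq_integral[OF inD])
  also have "\<dots> \<le> (\<integral>t. 2 * \<epsilon> * indicator A t + indicator ?D t \<partial>haar)"
  proof (rule integral_mono)
    show "integrable haar (\<lambda>t. norm (b' t - a' t))"
      using has_bochner_integral_simple_bochner_integrable[OF inD] by (rule integrable.intros)
    show "integrable haar (\<lambda>t. 2 * \<epsilon> * indicator A t + indicator ?D t)"
      using fA fD by (intro Bochner_Integration.integrable_add integrable_mult_right)
        (auto simp: integrable_indicator_iff fmeasurable_def)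
    fix t
    show "norm (b' t - a' t) \<le> 2 * \<epsilon> * indicator A t + indicator ?D t"
    proof (cases "t \<in> A")
      case tA: True
      have e: "0 \<le> \<epsilon>" using order_trans[OF norm_ge_zero near(1)[OF tA]] .
      show ?thesis
      proof (cases "- g + t \<in> A")
        case True
        have "norm (b (- g + t) - a t) \<le> norm (b (- g + t) - u t) + norm (a t - u t)"
          using norm_triangle_ineq4[of "b (- g + t) - u t" "a t - u t"] by simp
        also have "\<dots> \<le> \<epsilon> + \<epsilon>"
          using near(1)[OF tA] near(2)[OF True] by (simp add: add.assoc[symmetric])
        finally show ?thesis
          using tA True e by (simp add: a'_def b'_def add_increasing2)
      next
        case False
        then have "t \<in> ?D" using tA by (simp add: mem)
        with False tA e bound(1)[OF tA] show ?thesis by (simp add: a'_def b'_def)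
      qed
    next
      case tA: False
      show ?thesis
      proof (cases "- g + t \<in> A")
        case True
        then have "t \<in> ?D" using tA by (simp add: mem)
        with True tA bound(2)[OF True] show ?thesis by (simp add: a'_def b'_def)
      next
        case False
        with tA show ?thesis by (simp add: a'_def b'_def)
      qed
    qed
  qed
  also have "\<dots> = 2 * \<epsilon> * measure haar A + measure haar ?D"
    using fA fD by (subst Bochner_Integration.integral_add)
      (auto simp: integrable_indicator_iff fmeasurable_def)
  also have "\<dots> \<le> 3 * \<epsilon> * measure haar A"
    using sd by simp
  finally have "norm (?I (\<lambda>t. indicator A t *\<^sub>R b t) - ?I a') / measure haar A \<le> 3 * \<epsilon>"
    using A(2) by (simp add: pos_divide_le_eq)
  moreover have "haar_average A b - haar_average A a
      = (?I (\<lambda>t. indicator A t *\<^sub>R b t) - ?I a') /\<^sub>R measure haar A"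
    by (simp add: haar_average_def a'_def[abs_def] scaleR_diff_right)
  ultimately show ?thesis
    by (simp add: divide_inverse mult.commute)
qed


section \<open>Isometric actions\<close>

locale isometric_action =
  fixes \<alpha> :: "'g::haar_group \<Rightarrow> 'v::real_normed_vector \<Rightarrow> 'v"
  assumes linear: "linear (\<alpha> g)"
    and act_zero: "\<alpha> 0 v = v"
    and act_add: "\<alpha> (g + h) v = \<alpha> g (\<alpha> h v)"
    and norm_act: "norm (\<alpha> g v) = norm v"
begin

lemma act_diff: "\<alpha> g (v - w) = \<alpha> g v - \<alpha> g w"
  by (rule linear_diff[OF linear])

lemma norm_act_diff: "norm (\<alpha> g v - \<alpha> g w) = norm (v - w)"
  by (simp add: act_diff[symmetric] norm_act)

text \<open>
  The discretised form of \<open>\<parallel>g (\<beta> * v) - \<beta> * v\<parallel> \<le> \<parallel>g \<beta> - \<beta>\<parallel>\<close> for the uniform density \<open>\<beta>\<close> on \<open>A\<close>.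
\<close>

lemma translate_orbit_average_near:
  assumes A: "compact A" "0 < measure haar A" and \<sigma>: "simple_function haar \<sigma>"
    and near: "\<And>s. s \<in> A \<Longrightarrow> norm (\<alpha> (\<sigma> s) v - \<alpha> s v) \<le> \<epsilon>" and v: "norm v \<le> 1"
    and sd: "measure haar (sym_diff ((+) g ` A) A) \<le> \<epsilon> * measure haar A"
  shows "norm (\<alpha> g (haar_average A (\<lambda>s. \<alpha> (\<sigma> s) v)) - haar_average A (\<lambda>s. \<alpha> (\<sigma> s) v)) \<le> 3 * \<epsilon>"
proof -
  have sf: "simple_function haar (\<lambda>s. \<alpha> (\<sigma> s) v)" "simple_function haar (\<lambda>s. \<alpha> g (\<alpha> (\<sigma> s) v))"
    using \<sigma> by (rule simple_function_compose1)+
  have "norm (haar_average A (\<lambda>s. \<alpha> g (\<alpha> (\<sigma> s) v)) - haar_average A (\<lambda>s. \<alpha> (\<sigma> s) v)) \<le> 3 * \<epsilon>"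
    by (rule haar_average_translate[where u = "\<lambda>t. \<alpha> t v" and g = g, OF A sf near _ _ _ sd])
      (simp_all add: norm_act v act_add norm_act_diff near)
  then show ?thesis
    by (simp add: haar_average_linear[OF linear compact_fmeasurable[OF A(1)] sf(1)])
qed

end

text \<open>
  This supplies the nodes of the Riemann sums: \<open>\<sigma> s\<close> is the node that represents the point \<open>s\<close>.
\<close>

lemma simple_selector:
  fixes A :: "'g::haar_group set"
  assumes A: "compact A" and P: "\<And>y. y \<in> A \<Longrightarrow> \<forall>\<^sub>F s in nhds y. P y s"
  obtains \<sigma> :: "'g \<Rightarrow> 'g" where "simple_function haar \<sigma>" "\<And>s. s \<in> A \<Longrightarrow> \<sigma> s \<in> A" "\<And>s. s \<in> A \<Longrightarrow> P (\<sigma> s) s"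
proof -
  have "\<forall>y\<in>A. \<exists>N. open N \<and> y \<in> N \<and> (\<forall>s\<in>N. P y s)"
    using P unfolding eventually_nhds by blast
  then obtain N where N: "\<And>y. y \<in> A \<Longrightarrow> open (N y)" "\<And>y. y \<in> A \<Longrightarrow> y \<in> N y"
      "\<And>y s. y \<in> A \<Longrightarrow> s \<in> N y \<Longrightarrow> P y s"
    by metis
  have "A \<subseteq> (\<Union>y\<in>A. N y)" using N(2) by blast
  then obtain F where F: "F \<subseteq> A" "finite F" "A \<subseteq> (\<Union>y\<in>F. N y)"
    using compactE_image[OF A, of A N] N(1) by metis
  have "\<exists>\<sigma> :: 'g \<Rightarrow> 'g. simple_function haar \<sigma> \<and> (\<forall>s\<in>(\<Union>y\<in>F. N y). \<sigma> s \<in> F \<and> s \<in> N (\<sigma> s))"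
    using F(2,1)
  proof (induction F rule: finite_induct)
    case empty
    show ?case by (rule exI[of _ "\<lambda>_. 0"]) simp
  next
    case (insert y F)
    then obtain \<sigma> :: "'g \<Rightarrow> 'g" where \<sigma>: "simple_function haar \<sigma>"
        "\<forall>s\<in>(\<Union>y\<in>F. N y). \<sigma> s \<in> F \<and> s \<in> N (\<sigma> s)"
      by auto
    have "simple_function haar (\<lambda>s. if s \<in> N y then y else \<sigma> s)"
      using \<sigma>(1) N(1)[of y] insert.prems by (intro simple_function_If_set) auto
    then show ?case
      using \<sigma>(2) by (intro exI[of _ "\<lambda>s. if s \<in> N y then y else \<sigma> s"]) auto
  qed
  then show ?thesis
    using that F N(3) by (metis subsetD)
qed

text \<open>
  The sets \<open>A\<close> and \<open>B\<close> below carry the measures \<open>\<beta>\<close> and (after inversion) \<open>\<eta>\<close> of the introduction. The vector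
  \<open>T\<close> is the Riemann sum for \<open>\<beta> * v\<close>, and \<open>R w\<close> is the one for \<open>\<eta> * w\<close>. For \<open>g \<in> K \<union> {0}\<close> both \<open>\<alpha> g T\<close> and \<open>R v\<close>
  are close to \<open>R (\<alpha> g T)\<close>. What matters is the order of choices: \<open>F\<close> is fixed before the action and the
  vector, and the nodes \<open>\<sigma>\<close> and \<open>\<tau>\<close> are adapted to the vector afterwards.
\<close>

lemma finite_test_set:
  fixes K :: "'g::haar_group set"
  assumes K: "compact K" and \<epsilon>: "0 < \<epsilon>"
  obtains F where "finite F"
    "\<And>(\<alpha> :: 'g \<Rightarrow> 'v::real_normed_vector \<Rightarrow> 'v) v C.
      \<lbrakk>isometric_action \<alpha>; norm v \<le> 1; continuous_on UNIV (\<lambda>g. \<alpha> g v); invariant_vector \<alpha> F \<epsilon> v;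
        convex C; \<And>g. \<alpha> g v \<in> C\<rbrakk> \<Longrightarrow> \<exists>w\<in>C. invariant_vector \<alpha> K (15 * \<epsilon>) w"
proof -
  define K0 where "K0 = insert 0 K"
  have K0: "compact K0" using K by (simp add: K0_def)
  obtain A :: "'g set" where A: "compact A" "0 < measure haar A"
    by (rule compact_haar_pos_in_open[OF open_UNIV]) auto
  have "\<forall>\<^sub>F g in nhds 0. measure haar (sym_diff ((+) g ` A) A) < \<epsilon> * measure haar A"
    by (rule eventually_translate_compact_near[OF A(1)]) (simp add: \<epsilon> A(2))
  then obtain N where N: "open N" "0 \<in> N"
      "\<And>g. g \<in> N \<Longrightarrow> measure haar (sym_diff ((+) g ` A) A) < \<epsilon> * measure haar A"
    unfolding eventually_nhds by blast
  \<comment> \<open>Moving \<open>g T\<close> by \<open>u\<close> is moving \<open>T\<close> by the conjugate \<open>- g + u + g\<close>, which therefore has to stay in \<open>N\<close>.\<close>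
  have "open ((\<lambda>p::'g \<times> 'g. - snd p + fst p + snd p) -` N)"
    using N(1) by (intro open_vimage continuous_intros)
  then have "\<forall>\<^sub>F u in nhds 0. \<forall>g\<in>K0. (u, g) \<in> (\<lambda>p. - snd p + fst p + snd p) -` N"
    using N(2) by (intro eventually_nhds_uniformly_on_compact[OF K0]) auto
  then obtain U where U: "open U" "0 \<in> U" "\<And>u g. u \<in> U \<Longrightarrow> g \<in> K0 \<Longrightarrow> - g + u + g \<in> N"
    unfolding eventually_nhds by auto
  have "open (uminus -` U)" using U(1) by (intro open_vimage continuous_intros)
  moreover have "0 \<in> uminus -` U" using U(2) by simp
  then have "uminus -` U \<noteq> {}" by blast
  ultimately obtain B where B: "compact B" "B \<subseteq> uminus -` U" "0 < measure haar B"
    by (rule compact_haar_pos_in_open)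
  have "\<forall>\<^sub>F g in nhds 0. measure haar (sym_diff ((+) g ` B) B) < \<epsilon> * measure haar B"
    by (rule eventually_translate_compact_near[OF B(1)]) (simp add: \<epsilon> B(3))
  then obtain V where V: "open V" "0 \<in> V"
      "\<And>g. g \<in> V \<Longrightarrow> measure haar (sym_diff ((+) g ` B) B) < \<epsilon> * measure haar B"
    unfolding eventually_nhds by blast
  \<comment> \<open>The nodes for \<open>\<eta>\<close> can be chosen to work uniformly for all \<open>y\<close> in a compact set \<open>Q\<close> only.\<close>
  obtain U0 Q :: "'g set" where Q: "open U0" "compact Q" "0 \<in> U0" "U0 \<subseteq> Q"
    using compact_neighbourhood[of 0] by blast
  define V' where "V' = U0 \<inter> uminus -` V"
  have V': "open V'" "0 \<in> V'"
    using V Q unfolding V'_def by (auto intro!: open_Int open_vimage continuous_intros)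
  have L: "compact ((\<lambda>p. fst p + snd p) ` (K0 \<times> A))"
    using K0 A(1) by (intro compact_continuous_image continuous_intros compact_Times)
  have cover: "(\<lambda>p. fst p + snd p) ` (K0 \<times> A) \<subseteq> (\<Union>z\<in>UNIV. (\<lambda>x. x - z) -` V')"
  proof
    fix x
    have "x \<in> (\<lambda>y. y - x) -` V'" using V'(2) by simp
    then show "x \<in> (\<Union>z\<in>UNIV. (\<lambda>x. x - z) -` V')" by blast
  qed
  have "open ((\<lambda>x. x - z) -` V')" if "z \<in> UNIV" for z
    using V'(1) by (intro open_vimage continuous_intros)
  from L this cover obtain F where F: "F \<subseteq> UNIV" "finite F" "(\<lambda>p. fst p + snd p) ` (K0 \<times> A) \<subseteq> (\<Union>z\<in>F. (\<lambda>x. x - z) -` V')"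
    by (rule compactE_image)
  show ?thesis
  proof (rule that[OF F(2)])
    fix \<alpha> :: "'g \<Rightarrow> 'v \<Rightarrow> 'v" and v C
    assume \<alpha>: "isometric_action \<alpha>" and v: "norm v \<le> 1"
      and cont: "continuous_on UNIV (\<lambda>g. \<alpha> g v)" and inv: "invariant_vector \<alpha> F \<epsilon> v"
      and C: "convex C" "\<And>g. \<alpha> g v \<in> C"
    interpret isometric_action \<alpha> by fact
    have ev: "\<forall>\<^sub>F s in nhds y. norm (\<alpha> y v - \<alpha> s v) \<le> \<epsilon>" for y
    proof -
      have "((\<lambda>g. \<alpha> g v) \<longlongrightarrow> \<alpha> y v) (nhds y)"
        using cont by (intro tendsto_at_iff_tendsto_nhds[THEN iffD1]) (simp add: continuous_on_def)
      from tendstoD[OF this \<epsilon>] show ?thesis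
        by eventually_elim (simp add: dist_norm norm_minus_commute)
    qed
    obtain \<sigma> where \<sigma>: "simple_function haar \<sigma>" "\<And>s. s \<in> A \<Longrightarrow> \<sigma> s \<in> A"
        "\<And>s. s \<in> A \<Longrightarrow> norm (\<alpha> (\<sigma> s) v - \<alpha> s v) \<le> \<epsilon>"
      by (rule simple_selector[OF A(1) ev]) auto
    have ev': "\<forall>\<^sub>F p in nhds y. \<forall>q\<in>Q. norm (\<alpha> (- y + q) v - \<alpha> (- p + q) v) \<le> \<epsilon>" for y
    proof -
      let ?W = "{x. dist (\<alpha> (- y + snd x) v) (\<alpha> (- fst x + snd x) v) < \<epsilon>}"
      have "open ?W"
        by (intro open_Collect_less continuous_intros continuous_on_compose2[OF cont]) auto
      then have "\<forall>\<^sub>F p in nhds y. \<forall>q\<in>Q. (p, q) \<in> ?W"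
        using \<epsilon> by (intro eventually_nhds_uniformly_on_compact[OF Q(2)]) auto
      then show ?thesis
        by eventually_elim (auto simp: dist_norm less_imp_le)
    qed
    \<comment> \<open>The average over \<open>B\<close> is applied to translates \<open>\<alpha> q v\<close> of \<open>v\<close> as well; hence the quantifier over \<open>Q\<close>.\<close>
    obtain \<tau> where \<tau>: "simple_function haar \<tau>" "\<And>p. p \<in> B \<Longrightarrow> \<tau> p \<in> B"
        "\<And>p. p \<in> B \<Longrightarrow> \<forall>q\<in>Q. norm (\<alpha> (- \<tau> p + q) v - \<alpha> (- p + q) v) \<le> \<epsilon>"
      by (rule simple_selector[OF B(1) ev']) auto
    note fA = compact_fmeasurable[OF A(1)] and fB = compact_fmeasurable[OF B(1)]
    define T where "T = haar_average A (\<lambda>s. \<alpha> (\<sigma> s) v)"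
    define R where "R w = haar_average B (\<lambda>p. \<alpha> (- \<tau> p) w)" for w
    have sR: "simple_function haar (\<lambda>p. \<alpha> (- \<tau> p) w)" for w
      using \<tau>(1) by (rule simple_function_compose1)
    have R: "linear R"
    proof
      show "R (x + y) = R x + R y" for x y
        using haar_average_add[OF fB sR sR, of x y] by (simp add: R_def linear_add[OF linear])
      show "R (c *\<^sub>R x) = c *\<^sub>R R x" for c x
        using haar_average_linear[OF linear_scaleR fB sR, of c x]
        by (simp add: R_def linear_scale[OF linear])
    qed
    have R_near: "norm (R w - x) \<le> r" if "\<And>p. p \<in> B \<Longrightarrow> norm (\<alpha> (- \<tau> p) w - x) \<le> r" for w x r
      using haar_average_in_convex[OF fB B(3) sR convex_cball, of w x r] that
      by (simp add: R_def dist_norm norm_minus_commute)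
    have RT: "norm (R (\<alpha> g T) - \<alpha> g T) \<le> 3 * \<epsilon>" if g: "g \<in> K0" for g
    proof (rule R_near)
      fix p assume "p \<in> B"
      then have "- g + - \<tau> p + g \<in> N"
        using U(3)[of "- \<tau> p" g] g \<tau>(2) B(2) by auto
      then have "norm (\<alpha> (- g + - \<tau> p + g) T - T) \<le> 3 * \<epsilon>"
        unfolding T_def using N(3)
        by (intro translate_orbit_average_near[OF A \<sigma>(1,3) v]) (auto intro: less_imp_le)
      moreover have "- \<tau> p + g = g + (- g + - \<tau> p + g)"
        by (simp only: add.assoc[symmetric] add.right_inverse add_0_left)
      then have "\<alpha> (- \<tau> p) (\<alpha> g T) = \<alpha> g (\<alpha> (- g + - \<tau> p + g) T)"
        unfolding act_add[symmetric] by (rule arg_cong)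
      ultimately show "norm (\<alpha> (- \<tau> p) (\<alpha> g T) - \<alpha> g T) \<le> 3 * \<epsilon>"
        by (simp add: norm_act_diff)
    qed
    have RS: "norm (R (\<alpha> g (\<alpha> (\<sigma> s) v)) - R v) \<le> 4 * \<epsilon>" if g: "g \<in> K0" and s: "s \<in> A" for g s
    proof -
      obtain z where z: "z \<in> F" "g + \<sigma> s - z \<in> V'"
        using F(3) g \<sigma>(2)[OF s] by fastforce
      define y where "y = g + \<sigma> s - z"
      have y: "y \<in> Q" "- y \<in> V" using z(2) Q(4) by (auto simp: y_def V'_def)
      have "norm (R (\<alpha> y (\<alpha> z v - v)) - 0) \<le> \<epsilon>"
        using inv z(1) by (intro R_near) (auto simp: norm_act invariant_vector_def less_imp_le)
      moreover have "\<alpha> y (\<alpha> z v - v) = \<alpha> g (\<alpha> (\<sigma> s) v) - \<alpha> y v"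
        by (simp add: act_diff act_add[symmetric] y_def)
      ultimately have 1: "norm (R (\<alpha> g (\<alpha> (\<sigma> s) v)) - R (\<alpha> y v)) \<le> \<epsilon>"
        by (simp add: linear_diff[OF R])
      \<comment> \<open>Right translation of \<open>\<eta>\<close> by \<open>y\<close> becomes left translation of \<open>B\<close> by \<open>- y\<close> because of the inversion.\<close>
      have 2: "norm (R (\<alpha> y v) - R v) \<le> 3 * \<epsilon>"
        unfolding R_def
      proof (rule haar_average_translate[where u = "\<lambda>t. \<alpha> (- t) v" and g = "- y", OF B(1,3) sR sR])
        fix p assume p: "p \<in> B"
        show "norm (\<alpha> (- \<tau> p) v - \<alpha> (- p) v) \<le> \<epsilon>"
          using \<tau>(3)[OF p] Q(3,4) by (auto dest!: bspec[where x = 0])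
        show "norm (\<alpha> (- \<tau> p) (\<alpha> y v) - \<alpha> (- (- y + p)) v) \<le> \<epsilon>"
          using \<tau>(3)[OF p] y(1) by (simp add: act_add[symmetric] minus_add)
      qed (use v V(3)[OF y(2)] in \<open>auto simp: norm_act less_imp_le\<close>)
      show ?thesis
        using norm_triangle_ineq[of "R (\<alpha> g (\<alpha> (\<sigma> s) v)) - R (\<alpha> y v)" "R (\<alpha> y v) - R v"] 1 2 by simp
    qed
    have TS: "norm (\<alpha> g T - R v) \<le> 7 * \<epsilon>" if g: "g \<in> K0" for g
    proof -
      let ?D = "(\<lambda>w. R (\<alpha> g w)) -` cball (R v) (4 * \<epsilon>)"
      have "linear (\<lambda>w. R (\<alpha> g w))"
        using linear_compose[OF linear R] by (simp add: comp_def)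
      then have "convex ?D" by (intro convex_linear_vimage convex_cball)
      then have "T \<in> ?D"
        unfolding T_def using RS[OF g]
        by (intro haar_average_in_convex[OF fA A(2) simple_function_compose1[OF \<sigma>(1)]])
          (auto simp: dist_norm norm_minus_commute)
      then have "norm (R v - R (\<alpha> g T)) \<le> 4 * \<epsilon>" by (simp add: dist_norm)
      with RT[OF g] norm_triangle_ineq4[of "R (\<alpha> g T) - R v" "R (\<alpha> g T) - \<alpha> g T"]
      show ?thesis by (simp add: norm_minus_commute)
    qed
    show "\<exists>w\<in>C. invariant_vector \<alpha> K (15 * \<epsilon>) w"
    proof (rule bexI[of _ T])
      show "T \<in> C"
        unfolding T_def
        by (rule haar_average_in_convex[OF fA A(2) simple_function_compose1[OF \<sigma>(1)] C])
      show "invariant_vector \<alpha> K (15 * \<epsilon>) T"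
        unfolding invariant_vector_def
      proof
        fix g assume "g \<in> K"
        then have "norm (\<alpha> g T - R v) \<le> 7 * \<epsilon>" "norm (T - R v) \<le> 7 * \<epsilon>"
          using TS[of g] TS[of 0] by (auto simp: K0_def act_zero)
        then show "norm (\<alpha> g T - T) < 15 * \<epsilon>"
          using norm_triangle_ineq4[of "\<alpha> g T - R v" "T - R v"] \<epsilon> by simp
      qed
    qed
  qed
qed


section \<open>Continuity of the diagonal action\<close>

lemma norm_L1_indicator_diff:
  fixes A B :: "'g::haar_group set"
  assumes "A \<in> fmeasurable haar" "B \<in> fmeasurable haar"
  shows "norm (abs_L1 (\<lambda>t. indicator A t *\<^sub>R c) - abs_L1 (\<lambda>t. indicator B t *\<^sub>R c))
    = \<bar>c\<bar> * measure haar (sym_diff A B)"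
proof -
  have r: "L1_rel (\<lambda>t. indicator C t *\<^sub>R c) (\<lambda>t. indicator C t *\<^sub>R c)" if "C \<in> fmeasurable haar"
    for C :: "'g set"
    using that by (auto simp: L1_rel_def fmeasurable_def integrable_indicator_iff)
  have "abs_L1 (\<lambda>t. indicator A t *\<^sub>R c) - abs_L1 (\<lambda>t. indicator B t *\<^sub>R c)
      = abs_L1 (\<lambda>t. indicator A t *\<^sub>R c - indicator B t *\<^sub>R c)"
    by (rule minus_L1.abs_eq[OF r r]) fact+
  moreover have "L1_rel (\<lambda>t. indicator A t *\<^sub>R c - indicator B t *\<^sub>R c)
      (\<lambda>t. indicator A t *\<^sub>R c - indicator B t *\<^sub>R c)"
    using r[OF assms(1)] r[OF assms(2)] by (auto simp: L1_rel_def)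
  ultimately have "norm (abs_L1 (\<lambda>t. indicator A t *\<^sub>R c) - abs_L1 (\<lambda>t. indicator B t *\<^sub>R c))
      = (\<integral>t. \<bar>indicator A t *\<^sub>R c - indicator B t *\<^sub>R c\<bar> \<partial>haar)"
    by (simp only: norm_L1.abs_eq)
  also have "\<dots> = (\<integral>t. \<bar>c\<bar> * indicator (sym_diff A B) t \<partial>haar)"
    by (intro Bochner_Integration.integral_cong) (auto simp: indicator_def)
  also have "\<dots> = \<bar>c\<bar> * measure haar (sym_diff A B)"
    by simp
  finally show ?thesis .
qed

lemma L1_translate_indicator:
  fixes A :: "'g::haar_group set"
  assumes "A \<in> fmeasurable haar"
  shows "L1_translate g (abs_L1 (\<lambda>t. indicator A t *\<^sub>R c)) = abs_L1 (\<lambda>t. indicator ((+) g ` A) t *\<^sub>R c)"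
proof -
  have "L1_rel (\<lambda>t. indicator A t *\<^sub>R c) (\<lambda>t. indicator A t *\<^sub>R c)"
    using assms by (auto simp: L1_rel_def fmeasurable_def integrable_indicator_iff)
  moreover have "indicator A (- g + t) = (indicator ((+) g ` A) t :: real)" for t
    by (force simp: indicator_def image_iff add.assoc[symmetric])
  ultimately show ?thesis
    by (simp add: L1_translate.abs_eq)
qed

lemma fmeasurable_compact_approx:
  fixes A :: "'g::haar_group set"
  assumes A: "A \<in> fmeasurable haar" and "0 < \<delta>"
  obtains K where "compact K" "measure haar (sym_diff K A) < \<delta>"
proof -
  have sA: "A \<in> sets borel" using fmeasurableD[OF A] by simp
  from A obtain U where U: "open U" "A \<subseteq> U" and fU: "U \<in> fmeasurable haar"
      and UA: "measure haar (U - A) < \<delta> / 2"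
    by (rule fmeasurable_outer_approx[where \<delta> = "\<delta> / 2"]) (use \<open>0 < \<delta>\<close> in auto)
  have eU: "emeasure haar U = ennreal (measure haar U)"
    using fU by (simp add: emeasure_eq_measure2 fmeasurableD2)
  obtain K where K: "compact K" "K \<subseteq> U" "measure haar U - measure haar K \<le> \<delta> / 2"
  proof (cases "measure haar U \<le> \<delta> / 2")
    case True
    then show ?thesis using that[of "{}"] by simp
  next
    case False
    then have "ennreal (measure haar U - \<delta> / 2) < emeasure haar U"
      using \<open>0 < \<delta>\<close> unfolding eU by (simp add: ennreal_less_iff)
    then obtain K where K: "compact K" "K \<subseteq> U" "ennreal (measure haar U - \<delta> / 2) < emeasure haar K"
      by (rule haar_inner_regular[OF U(1)])
    have "emeasure haar K = ennreal (measure haar K)"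
      using compact_fmeasurable[OF K(1)] by (simp add: emeasure_eq_measure2 fmeasurableD2)
    then show ?thesis using that[OF K(1,2)] K(3) False by (simp add: ennreal_less_iff)
  qed
  have sK: "K \<in> sets borel" by (rule borel_compact[OF K(1)])
  have UK: "measure haar (U - K) \<le> \<delta> / 2"
    using K fU measurable_measure_Diff[of U haar K] sK by simp
  have "measure haar (sym_diff K A) \<le> measure haar ((U - A) \<union> (U - K))"
    using U(2) K(2) fU sA sK by (intro measure_mono_fmeasurable) (auto intro!: fmeasurable_Diff fmeasurable.Un)
  also have "\<dots> \<le> measure haar (U - A) + measure haar (U - K)"
    using U(1) sA sK by (intro measure_Un_le) auto
  finally show ?thesis using that[OF K(1)] UA UK by simp
qed

lemma L1_translate_zero: "L1_translate 0 u = u"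
  by transfer (simp add: L1_rel_def)

lemma L1_translate_translate:
  "L1_translate (g + h) u = L1_translate g (L1_translate h (u :: 'g::haar_group L1))"
proof transfer
  fix g h :: 'g and \<psi> :: "'g \<Rightarrow> real"
  assume "L1_rel \<psi> \<psi>"
  then have "integrable haar (\<lambda>t. \<psi> (- (g + h) + t))"
    by (intro integrable_left_translation) (simp add: L1_rel_def)
  moreover have "- h + (- g + t) = - (g + h) + t" for t
    unfolding minus_add by (rule add.assoc[symmetric])
  ultimately show "L1_rel (\<lambda>t. \<psi> (- (g + h) + t)) (\<lambda>t. \<psi> (- h + (- g + t)))"
    unfolding L1_rel_def by simp
qed

lemma L1_translate_plus: "L1_translate g (u + v) = L1_translate g u + L1_translate g v"
  by transfer (auto simp: L1_rel_def intro: integrable_left_translation)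

lemma L1_translate_scaleR: "L1_translate g (c *\<^sub>R u) = c *\<^sub>R L1_translate g u"
  by transfer (auto simp: L1_rel_def intro: integrable_left_translation)

lemma tendsto_L1_translate_limit:
  fixes u :: "nat \<Rightarrow> 'g::haar_group L1"
  assumes lim: "u \<longlonglongrightarrow> v" and u: "\<And>n. ((\<lambda>g. L1_translate g (u n)) \<longlongrightarrow> u n) (nhds 0)"
  shows "((\<lambda>g. L1_translate g v) \<longlongrightarrow> v) (nhds 0)"
proof (rule tendstoI)
  fix \<epsilon> :: real assume "0 < \<epsilon>"
  then have "\<forall>\<^sub>F n in sequentially. dist (u n) v < \<epsilon> / 3"
    using lim by (intro tendstoD) auto
  then obtain n where n: "dist (u n) v < \<epsilon> / 3"
    by (auto simp: eventually_sequentially)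
  have "\<forall>\<^sub>F g in nhds 0. dist (L1_translate g (u n)) (u n) < \<epsilon> / 3"
    using u \<open>0 < \<epsilon>\<close> by (intro tendstoD) auto
  then show "\<forall>\<^sub>F g in nhds 0. dist (L1_translate g v) v < \<epsilon>"
  proof eventually_elim
    case (elim g)
    have "dist (L1_translate g v) (L1_translate g (u n)) = dist (u n) v"
      by (simp add: dist_norm L1_translate_diff[symmetric] norm_L1_translate norm_minus_commute)
    with elim n show ?case
      using dist_triangle[of "L1_translate g v" v "L1_translate g (u n)"]
        dist_triangle[of "L1_translate g (u n)" v "u n"] by simp
  qed
qed

text \<open>
  Compact sets are dense in the sets of finite measure, and indicators of compact sets move continuously;
  the vectors with continuous orbit form a closed subspace.
\<close>

lemma tendsto_L1_translate_zero:
  "((\<lambda>g. L1_translate g u) \<longlongrightarrow> (u :: 'g::haar_group L1)) (nhds 0)"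
proof -
  have rel: "L1_rel \<psi> \<psi>" if "integrable haar \<psi>" for \<psi> :: "'g \<Rightarrow> real"
    using that by (simp add: L1_rel_def)
  have "((\<lambda>g. L1_translate g (abs_L1 \<psi>)) \<longlongrightarrow> abs_L1 \<psi>) (nhds 0)" if "integrable haar \<psi>"
    for \<psi> :: "'g \<Rightarrow> real"
    using that
  proof (induction rule: integrable_induct)
    case (base A c)
    then have fA: "A \<in> fmeasurable haar" by (simp add: fmeasurable_def)
    define w where "w B = abs_L1 (\<lambda>t. indicator B t *\<^sub>R c)" for B :: "'g set"
    have "\<exists>K. compact K \<and> measure haar (sym_diff K A) < inverse (real (Suc n))" for n
      using fmeasurable_compact_approx[OF fA, of "inverse (real (Suc n))"] by (metis inverse_positive_iff_positive of_nat_0_less_iff zero_less_Suc)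
    then obtain K where K: "\<And>n. compact (K n)"
        "\<And>n. measure haar (sym_diff (K n) A) < inverse (real (Suc n))"
      by metis
    have "(\<lambda>n. measure haar (sym_diff (K n) A)) \<longlonglongrightarrow> 0"
    proof (rule Lim_null_comparison[OF always_eventually LIMSEQ_inverse_real_of_nat], rule allI)
      show "norm (measure haar (sym_diff (K n) A)) \<le> inverse (real (Suc n))" for n
        using K(2)[of n] by simp
    qed
    from tendsto_mult_left[OF this, of "\<bar>c\<bar>"] have "(\<lambda>n. norm (w (K n) - w A)) \<longlonglongrightarrow> 0"
      by (simp only: w_def norm_L1_indicator_diff[OF compact_fmeasurable[OF K(1)] fA] mult_zero_right)
    then have lim: "(\<lambda>n. w (K n)) \<longlonglongrightarrow> w A"
      by (rule LIM_zero_cancel[OF tendsto_norm_zero_cancel])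
    have "((\<lambda>g. L1_translate g (w (K n))) \<longlongrightarrow> w (K n)) (nhds 0)" for n
    proof (rule tendstoI)
      fix \<epsilon> :: real assume e: "0 < \<epsilon>"
      have "\<forall>\<^sub>F g in nhds 0. measure haar (sym_diff ((+) g ` K n) (K n)) < \<epsilon> / (\<bar>c\<bar> + 1)"
        using e by (intro eventually_translate_compact_near[OF K(1)]) auto
      then show "\<forall>\<^sub>F g in nhds 0. dist (L1_translate g (w (K n))) (w (K n)) < \<epsilon>"
      proof eventually_elim
        case (elim g)
        have "dist (L1_translate g (w (K n))) (w (K n)) = \<bar>c\<bar> * measure haar (sym_diff ((+) g ` K n) (K n))"
          unfolding w_def dist_norm L1_translate_indicator[OF compact_fmeasurable[OF K(1)]]
          by (rule norm_L1_indicator_diff[OF compact_fmeasurable[OF compact_translate[OF K(1)]]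
              compact_fmeasurable[OF K(1)]])
        also have "\<dots> \<le> (\<bar>c\<bar> + 1) * measure haar (sym_diff ((+) g ` K n) (K n))"
          by (intro mult_right_mono) auto
        also have "\<dots> < \<epsilon>"
          using elim by (simp add: pos_less_divide_eq mult.commute)
        finally show ?case .
      qed
    qed
    then have "((\<lambda>g. L1_translate g (w A)) \<longlongrightarrow> w A) (nhds 0)"
      by (rule tendsto_L1_translate_limit[OF lim])
    then show ?case by (simp add: w_def)
  next
    case (add \<phi> \<psi>)
    have "abs_L1 (\<lambda>t. \<phi> t + \<psi> t) = abs_L1 \<phi> + abs_L1 \<psi>"
      by (rule plus_L1.abs_eq[OF rel rel, symmetric]) fact+
    then show ?case
      using tendsto_add[OF add.IH] by (simp add: L1_translate_plus)
  next
    case (lim \<psi> s)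
    have "norm (abs_L1 (s n) - abs_L1 \<psi>) = (\<integral>t. \<bar>s n t - \<psi> t\<bar> \<partial>haar)" for n
    proof -
      have "abs_L1 (s n) - abs_L1 \<psi> = abs_L1 (\<lambda>t. s n t - \<psi> t)"
        using lim.hyps(1,4) by (intro minus_L1.abs_eq rel)
      moreover have "L1_rel (\<lambda>t. s n t - \<psi> t) (\<lambda>t. s n t - \<psi> t)"
        using lim.hyps(1,4) by (intro rel Bochner_Integration.integrable_diff)
      ultimately show ?thesis by (simp only: norm_L1.abs_eq)
    qed
    moreover have "(\<lambda>n. \<integral>t. \<bar>s n t - \<psi> t\<bar> \<partial>haar) \<longlonglongrightarrow> (\<integral>t. 0 \<partial>(haar :: 'g measure))"
    proof (rule integral_dominated_convergence[where w = "\<lambda>t. 3 * \<bar>\<psi> t\<bar>"])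
      show "integrable haar (\<lambda>t. 3 * \<bar>\<psi> t\<bar>)" using lim.hyps(4) by simp
      show "AE t in haar. (\<lambda>n. \<bar>s n t - \<psi> t\<bar>) \<longlonglongrightarrow> 0"
      proof (rule AE_I2)
        fix t :: 'g assume "t \<in> space haar"
        then have "(\<lambda>n. s n t) \<longlonglongrightarrow> \<psi> t" by (rule lim.hyps(2))
        then show "(\<lambda>n. \<bar>s n t - \<psi> t\<bar>) \<longlonglongrightarrow> 0"
          by (rule tendsto_rabs_zero[OF LIM_zero])
      qed
      show "AE t in haar. norm \<bar>s n t - \<psi> t\<bar> \<le> 3 * \<bar>\<psi> t\<bar>" for n
      proof (rule AE_I2)
        fix t :: 'g assume "t \<in> space haar"
        from lim.hyps(3)[OF this, of n] show "norm \<bar>s n t - \<psi> t\<bar> \<le> 3 * \<bar>\<psi> t\<bar>"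
          by simp
      qed
      show "(\<lambda>t. \<bar>s n t - \<psi> t\<bar>) \<in> borel_measurable haar" for n
        using lim.hyps(1)[of n] lim.hyps(4) by (intro borel_measurable_abs borel_measurable_diff) auto
    qed simp
    ultimately have "(\<lambda>n. norm (abs_L1 (s n) - abs_L1 \<psi>)) \<longlonglongrightarrow> 0" by simp
    then have "(\<lambda>n. abs_L1 (s n)) \<longlonglongrightarrow> abs_L1 \<psi>"
      by (rule LIM_zero_cancel[OF tendsto_norm_zero_cancel])
    then show ?case
      by (rule tendsto_L1_translate_limit) (rule lim.IH)
  qed
  then show ?thesis
    by (induction u rule: L1.abs_induct) (simp add: L1_rel_def)
qed

lemma tendsto_L1_translate:
  fixes f :: "'a \<Rightarrow> 'g::haar_group"
  assumes f: "(f \<longlongrightarrow> g) F" and h: "(h \<longlongrightarrow> u) F"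
  shows "((\<lambda>x. L1_translate (f x) (h x)) \<longlongrightarrow> L1_translate g u) F"
proof -
  have "((\<lambda>x. - g + f x) \<longlongrightarrow> 0) F"
    using tendsto_add[OF tendsto_const[of "- g"] f] by simp
  then have "((\<lambda>x. L1_translate (- g + f x) u) \<longlongrightarrow> u) F"
    by (rule filterlim_compose[OF tendsto_L1_translate_zero])
  with h have "((\<lambda>x. dist (h x) u + dist (L1_translate (- g + f x) u) u) \<longlongrightarrow> 0 + 0) F"
    by (intro tendsto_add) (simp_all only: tendsto_dist_iff[symmetric])
  then have lim: "((\<lambda>x. dist (h x) u + dist (L1_translate (- g + f x) u) u) \<longlongrightarrow> 0) F"
    by simp
  have le: "dist (L1_translate (f x) (h x)) (L1_translate g u)
      \<le> dist (h x) u + dist (L1_translate (- g + f x) u) u" for x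
  proof -
    have "dist (L1_translate k v) (L1_translate k w) = dist v w" for k and v w :: "'g L1"
      by (simp add: dist_norm L1_translate_diff[symmetric] norm_L1_translate)
    from this[of "f x" "h x" u] this[of g "L1_translate (- g + f x) u" u]
    show ?thesis
      using dist_triangle[of "L1_translate (f x) (h x)" "L1_translate g u" "L1_translate (f x) u"]
      by (simp add: L1_translate_translate[symmetric] add.assoc[symmetric])
  qed
  from lim have "((\<lambda>x. dist (L1_translate (f x) (h x)) (L1_translate g u)) \<longlongrightarrow> 0) F"
  proof (rule Lim_null_comparison[rotated])
    show "\<forall>\<^sub>F x in F. norm (dist (L1_translate (f x) (h x)) (L1_translate g u))
        \<le> dist (h x) u + dist (L1_translate (- g + f x) u) u"
      using le by (intro always_eventually) simp
  qed
  then show ?thesis by (subst tendsto_dist_iff)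
qed

lemma isometric_action_diagonal:
  fixes act :: "'g::haar_group \<Rightarrow> 'x::topological_space \<Rightarrow> 'x"
  assumes act: "continuous_G_space act"
  shows "isometric_action (diagonal_action act)"
proof
  note app = apply_diagonal_action[OF act]
  have a0: "act 0 x = x" and aa: "act (g + h) x = act g (act h x)" for g h x
    using act by (auto simp: continuous_G_space_def)
  fix g h and f f' :: "'x \<Rightarrow>\<^sub>C 'g L1" and c :: real
  show "diagonal_action act g (f + f') = diagonal_action act g f + diagonal_action act g f'"
    by (rule bcontfun_eqI) (simp add: app plus_bcontfun.rep_eq L1_translate_plus)
  show "diagonal_action act g (c *\<^sub>R f) = c *\<^sub>R diagonal_action act g f"
    by (rule bcontfun_eqI) (simp add: app scaleR_bcontfun.rep_eq L1_translate_scaleR)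
  show zero: "diagonal_action act 0 f = f" for f
    by (rule bcontfun_eqI) (simp add: app L1_translate_zero a0)
  show add: "diagonal_action act (g + h) f = diagonal_action act g (diagonal_action act h f)" for g h f
  proof (rule bcontfun_eqI)
    fix x
    have "act (- (g + h)) x = act (- h) (act (- g) x)"
      by (metis aa minus_add)
    then show "apply_bcontfun (diagonal_action act (g + h) f) x
        = apply_bcontfun (diagonal_action act g (diagonal_action act h f)) x"
      by (simp add: app L1_translate_translate)
  qed
  have le: "norm (diagonal_action act g f) \<le> norm f" for g and f :: "'x \<Rightarrow>\<^sub>C 'g L1"
    by (rule norm_bound) (simp add: app norm_L1_translate norm_bounded)
  have "norm f \<le> norm (diagonal_action act g f)"
    using le[of "- g" "diagonal_action act g f"] by (simp add: add[symmetric] zero)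
  with le[of g f] show "norm (diagonal_action act g f) = norm f" by simp
qed

text \<open>
  The value \<open>L1_translate g (f (act (- g) x))\<close> is jointly continuous in \<open>g\<close> and \<open>x\<close>, because translation is jointly
  continuous on \<open>G \<times> L\<^sup>1 G\<close>. Compactness of \<open>X\<close> makes the continuity in \<open>g\<close> uniform in \<open>x\<close>.
\<close>

lemma continuous_on_diagonal_action:
  fixes act :: "'g::haar_group \<Rightarrow> 'x::t2_space \<Rightarrow> 'x"
  assumes X: "compact (UNIV :: 'x set)" and act: "continuous_G_space act"
  shows "continuous_on UNIV (\<lambda>g. diagonal_action act g f)"
proof -
  note app = apply_diagonal_action[OF act]
  define \<Phi> where "\<Phi> p = L1_translate (fst p) (apply_bcontfun f (act (- fst p) (snd p)))" for p
  have "continuous_on UNIV (\<lambda>p :: 'g \<times> 'x. (- fst p, snd p))"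
    by (intro continuous_intros)
  then have "continuous_on UNIV (\<lambda>p. act (- fst p) (snd p))"
    using act continuous_on_compose2[of UNIV "\<lambda>(g, x). act g x" UNIV "\<lambda>p. (- fst p, snd p)"]
    unfolding continuous_G_space_def by simp
  then have "continuous_on UNIV (\<lambda>p. apply_bcontfun f (act (- fst p) (snd p)))"
    using continuous_on_compose2[OF continuous_on_apply_bcontfun[of UNIV f]] by blast
  then have \<Phi>: "continuous_on UNIV \<Phi>"
    unfolding \<Phi>_def continuous_on_def
    by (intro ballI tendsto_L1_translate tendsto_fst tendsto_ident_at) (erule bspec)
  have "((\<lambda>g. diagonal_action act g f) \<longlongrightarrow> diagonal_action act h f) (nhds h)" for h
  proof (rule tendstoI)
    fix \<epsilon> :: real assume e: "0 < \<epsilon>"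
    let ?W = "{p. dist (\<Phi> p) (\<Phi> (h, snd p)) < \<epsilon> / 2}"
    have "open ?W"
      by (intro open_Collect_less continuous_intros continuous_on_compose2[OF \<Phi>]) auto
    then have "\<forall>\<^sub>F g in nhds h. \<forall>x\<in>UNIV. (g, x) \<in> ?W"
      using e by (intro eventually_nhds_uniformly_on_compact[OF X]) auto
    then show "\<forall>\<^sub>F g in nhds h. dist (diagonal_action act g f) (diagonal_action act h f) < \<epsilon>"
    proof eventually_elim
      case (elim g)
      have "dist (diagonal_action act g f) (diagonal_action act h f) \<le> \<epsilon> / 2"
        using elim by (intro dist_bound) (auto simp: app \<Phi>_def less_imp_le)
      with e show ?case by simp
    qed
  qed
  then show ?thesis
    by (auto simp: continuous_on_def intro!: tendsto_at_iff_tendsto_nhds[THEN iffD2])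
qed

section \<open>Probability densities\<close>

lemma convex_prob_densities: "convex (prob_densities :: 'g::haar_group L1 set)"
proof (rule convexI)
  fix u v :: "'g L1" and a b :: real
  assume uv: "u \<in> prob_densities" "v \<in> prob_densities" and ab: "0 \<le> a" "0 \<le> b" "a + b = 1"
  have nn: "L1_nonneg u \<Longrightarrow> L1_nonneg v \<Longrightarrow> L1_nonneg (a *\<^sub>R u + b *\<^sub>R v)"
    using ab(1,2) by transfer (auto elim!: eventually_elim2)
  have "L1_integral (a *\<^sub>R u + b *\<^sub>R v) = a * L1_integral u + b * L1_integral v"
    by transfer (auto simp: L1_rel_def)
  with nn uv ab(3) show "a *\<^sub>R u + b *\<^sub>R v \<in> prob_densities"
    by (simp add: prob_densities_def)
qed

lemma L1_translate_prob_densities: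
  assumes "u \<in> prob_densities"
  shows "L1_translate g u \<in> prob_densities"
proof -
  have "L1_nonneg u \<Longrightarrow> L1_nonneg (L1_translate g u)"
    by transfer (rule AE_left_translation)
  moreover have "L1_integral (L1_translate g u) = L1_integral u"
    by transfer (auto simp: L1_rel_def integral_left_translation)
  ultimately show ?thesis using assms by (simp add: prob_densities_def)
qed

lemma norm_prob_densities:
  assumes "u \<in> prob_densities"
  shows "norm u = 1"
proof -
  have "L1_nonneg u \<Longrightarrow> norm u = L1_integral u"
    by transfer (auto simp: L1_rel_def intro!: integral_cong_AE)
  then show ?thesis using assms by (simp add: prob_densities_def)
qed

theorem mainTheorem2:
  fixes act :: "'g::haar_group \<Rightarrow> 'x::t2_space \<Rightarrow> 'x"
  assumes "compact (UNIV :: 'x set)"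
    and "continuous_G_space act"
  shows "property_P1 act \<longleftrightarrow> property_P1_star act"
proof
  assume "property_P1 act"
  then show "property_P1_star act"
    unfolding property_P1_def property_P1_star_def using finite_imp_compact by blast
next
  assume star: "property_P1_star act"
  let ?C = "{f :: 'x \<Rightarrow>\<^sub>C 'g L1. range (apply_bcontfun f) \<subseteq> prob_densities}"
  have C: "convex ?C"
  proof (rule convexI)
    fix f f' :: "'x \<Rightarrow>\<^sub>C 'g L1" and a b :: real
    assume "f \<in> ?C" "f' \<in> ?C" "0 \<le> a" "0 \<le> b" "a + b = 1"
    then show "a *\<^sub>R f + b *\<^sub>R f' \<in> ?C"
      by (auto simp: plus_bcontfun.rep_eq scaleR_bcontfun.rep_eq intro!: convexD[OF convex_prob_densities])
  qed
  show "property_P1 act"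
    unfolding property_P1_def
  proof (intro allI impI)
    fix K :: "'g set" and \<epsilon> :: real
    assume K: "compact K" and e: "0 < \<epsilon>"
    obtain F where F: "finite F"
      "\<And>(\<alpha> :: 'g \<Rightarrow> ('x \<Rightarrow>\<^sub>C 'g L1) \<Rightarrow> ('x \<Rightarrow>\<^sub>C 'g L1)) f C.
        \<lbrakk>isometric_action \<alpha>; norm f \<le> 1; continuous_on UNIV (\<lambda>g. \<alpha> g f); invariant_vector \<alpha> F (\<epsilon> / 15) f;
        convex C; \<And>g. \<alpha> g f \<in> C\<rbrakk> \<Longrightarrow> \<exists>w\<in>C. invariant_vector \<alpha> K (15 * (\<epsilon> / 15)) w"
      using finite_test_set[OF K, of "\<epsilon> / 15"] e by (metis divide_pos_pos zero_less_numeral)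
    obtain f :: "'x \<Rightarrow>\<^sub>C 'g L1" where f: "invariant_vector (diagonal_action act) F (\<epsilon> / 15) f"
        "range (apply_bcontfun f) \<subseteq> prob_densities"
      using star F(1) e unfolding property_P1_star_def by (metis divide_pos_pos zero_less_numeral)
    have "\<exists>w\<in>?C. invariant_vector (diagonal_action act) K (15 * (\<epsilon> / 15)) w"
    proof (rule F(2)[OF isometric_action_diagonal[OF assms(2)] _ continuous_on_diagonal_action[OF assms] f(1) C])
      show "norm f \<le> 1"
        using f(2) by (intro norm_bound) (simp add: norm_prob_densities image_subset_iff)
      show "diagonal_action act g f \<in> ?C" for g
        using f(2) by (auto simp: apply_diagonal_action[OF assms(2)] intro!: L1_translate_prob_densities)
    qed
    then show "\<exists>f. invariant_vector (diagonal_action act) K \<epsilon> f \<and> range (apply_bcontfun f) \<subseteq> prob_densities"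
      by auto
  qed
qed

end
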